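(* Let $T\in\mathbb{N}$, $T\ge1$, and $\theta\in(0,1)$. For each $t\in\mathbb{N}_{[0,T]}$ let $E_{\theta,t}$ be a PRS of the stochastic fluctuation $e_t$ at probability level $1-\theta$, and let $\tilde E_\theta=\bigcup_{t=0}^T E_{\theta,t}$. Fix an initial state $x_0=X_0\in\mathcal{X}_0$ and a disturbance sequence $d_t\in\mathcal{D}$, and let $\boldsymbol{X}_{[0,T]}$ and $\boldsymbol{x}_{[0,T]}$ be the associated stochastic and deterministic trajectories. Let $\varphi$ be a negation-free STL formula of horizon $T$ constructed from predicates $\pi_1,\dots,\pi_m$ with superlevel sets $\mathcal{C}_1,\dots,\mathcal{C}_m$. Let $\tilde\varphi$ be the formula obtained from $\varphi$ by replacing each $\pi_i$ by a predicate $\tilde\pi_i$ whose superlevel set is $\mathcal{C}_i\ominus\tilde E_\theta$, keeping all other operators unchanged. Then $\boldsymbol{x}_{[0,T]}\models\tilde\varphi$ implies $\mathbb{P}(\boldsymbol{X}_{[0,T]}\models\varphi)\ge 1-T\theta$.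
   Context: System: $X_{t+1}=f(X_t,d_t,t)+w_t$ (stochastic) and $x_{t+1}=f(x_t,d_t,t)$ (deterministic), with $X_t,x_t\in\mathbb{R}^n$, $d_t\in\mathcal{D}$ a bounded set, $w_t$ random in $\mathbb{R}^n$, initial set $\mathcal{X}_0$. Associated trajectories share the initial state and the disturbance sequence $(d_t)$; the stochastic fluctuation is $e_t=X_t-x_t$. A set $E_{\theta,t}$ is a PRS of $e_t$ at level $1-\theta$ if for any $x_0=X_0\in\mathcal{X}_0$ and any $d_s\in\mathcal{D}$, $0\le s\le t$, $\mathbb{P}(e_t\in E_{\theta,t})\ge1-\theta$. $A\ominus B=\{x:x+y\in A\ \forall y\in B\}$. STL (negation-free fragment): formulas are built by $\varphi::=\mathsf{T}\mid\pi\mid\varphi_1\wedge\varphi_2\mid\varphi_1\vee\varphi_2\mid\varphi_1\,\mathcal{U}_{[t_1,t_2]}\varphi_2\mid\lozenge_{[t_1,t_2]}\varphi\mid\square_{[t_1,t_2]}\varphi$, where a predicate is $\pi=(\mu(x)\ge0)$ with superlevel set $\{x:\mu(x)\ge0\}$. Semantics on a trajectory: $\boldsymbol{x}_{[t,\cdot]}\models\pi\iff\mu(x_t)\ge0$; $\wedge,\vee$ as usual; $\boldsymbol{x}_{[t,\cdot]}\models\varphi_1\mathcal{U}_{[t_1,t_2]}\varphi_2$ iff there is $\tau\in\mathbb{N}_{[t+t_1,t+t_2]}$ with $\boldsymbol{x}_{[\tau,\cdot]}\models\varphi_2$ and $\boldsymbol{x}_{[\tau',\cdot]}\models\varphi_1$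 for all $\tau'\in\mathbb{N}_{[t,\tau]}$; $\lozenge_{[t_1,t_2]}\varphi=\mathsf{T}\,\mathcal{U}_{[t_1,t_2]}\varphi$; $\boldsymbol{x}_{[t,\cdot]}\models\square_{[t_1,t_2]}\varphi$ iff $\boldsymbol{x}_{[\tau,\cdot]}\models\varphi$ for all $\tau\in\mathbb{N}_{[t+t_1,t+t_2]}$. The horizon $h^\varphi$ is defined by $h^\pi=0$, $h^{\varphi_1\wedge\varphi_2}=h^{\varphi_1\vee\varphi_2}=\max(h^{\varphi_1},h^{\varphi_2})$, $h^{\varphi_1\mathcal{U}_{[t_1,t_2]}\varphi_2}=t_2+\max(h^{\varphi_1},h^{\varphi_2})$ (similarly for $\lozenge,\square$); it is the trajectory length needed to evaluate $\varphi$. $\boldsymbol{x}_{[0,T]}\models\varphi$ means satisfaction at time $0$. *)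

theory Defs
  imports "HOL-Probability.Probability"
begin

primrec det_traj ::
  "(real^'n \<Rightarrow> 'd \<Rightarrow> nat \<Rightarrow> real^'n) \<Rightarrow> real^'n \<Rightarrow> (nat \<Rightarrow> 'd) \<Rightarrow> nat \<Rightarrow> real^'n"
where
  "det_traj f x0 d 0 = x0"
| "det_traj f x0 d (Suc t) = f (det_traj f x0 d t) (d t) t"

primrec stoch_traj ::
  "(real^'n \<Rightarrow> 'd \<Rightarrow> nat \<Rightarrow> real^'n) \<Rightarrow> (nat \<Rightarrow> 'w \<Rightarrow> real^'n) \<Rightarrow> real^'n \<Rightarrow> (nat \<Rightarrow> 'd)
    \<Rightarrow> nat \<Rightarrow> 'w \<Rightarrow> real^'n"
where
  "stoch_traj f w x0 d 0 \<omega> = x0"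
| "stoch_traj f w x0 d (Suc t) \<omega> = f (stoch_traj f w x0 d t \<omega>) (d t) t + w t \<omega>"

definition fluctuation ::
  "(real^'n \<Rightarrow> 'd \<Rightarrow> nat \<Rightarrow> real^'n) \<Rightarrow> (nat \<Rightarrow> 'w \<Rightarrow> real^'n) \<Rightarrow> real^'n \<Rightarrow> (nat \<Rightarrow> 'd)
    \<Rightarrow> nat \<Rightarrow> 'w \<Rightarrow> real^'n"
where
  "fluctuation f w x0 d t \<omega> = stoch_traj f w x0 d t \<omega> - det_traj f x0 d t"

text \<open>Probabilistic reachable set of the fluctuation at time \<open>t\<close> and level \<open>1 - \<theta>\<close>.
  As \<open>measure\<close> is \<open>0\<close> on non-measurable sets, for \<open>\<theta> < 1\<close> the inequality
  includes that the event is measurable.\<close>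

definition is_PRS ::
  "'w measure \<Rightarrow> (real^'n \<Rightarrow> 'd \<Rightarrow> nat \<Rightarrow> real^'n) \<Rightarrow> (nat \<Rightarrow> 'w \<Rightarrow> real^'n)
    \<Rightarrow> (real^'n) set \<Rightarrow> 'd set \<Rightarrow> real \<Rightarrow> nat \<Rightarrow> (real^'n) set \<Rightarrow> bool"
where
  "is_PRS M f w X0 D \<theta> t E \<longleftrightarrow>
     (\<forall>x0\<in>X0. \<forall>d. (\<forall>s\<le>t. d s \<in> D) \<longrightarrow>
        measure M {\<omega> \<in> space M. fluctuation f w x0 d t \<omega> \<in> E} \<ge> 1 - \<theta>)"

definition pontryagin_diff :: "'x::plus set \<Rightarrow> 'x set \<Rightarrow> 'x set"  (infixl "\<ominus>\<^sub>P" 65)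
  where "A \<ominus>\<^sub>P B = {x. \<forall>y\<in>B. x + y \<in> A}"

text \<open>The parameter \<open>'p\<close> is the type of predicate symbols.  A formula to be evaluated on
  trajectories in \<open>'x\<close> has \<open>'p = 'x \<Rightarrow> real\<close>, the function \<open>\<mu>\<close> representing the
  predicate \<open>\<mu> x \<ge> 0\<close>.  For \<open>\<Phi> :: nat stl\<close>, whose atoms are indices, \<open>map_stl \<mu> \<Phi>\<close> is
  the formula with predicate \<open>\<mu> i\<close> at every occurrence of the index \<open>i\<close>.\<close>

datatype (preds: 'p) stl =
    Tt
  | Pred 'p
  | Conj "'p stl" "'p stl"
  | Disj "'p stl" "'p stl"
  | Until nat nat "'p stl" "'p stl"
  | Eventually nat nat "'p stl"
  | Always nat nat "'p stl"
  for map: map_stl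

definition superlevel :: "('x \<Rightarrow> real) \<Rightarrow> 'x set"
  where "superlevel \<mu> = {x. \<mu> x \<ge> 0}"

primrec sat :: "(nat \<Rightarrow> 'x) \<Rightarrow> nat \<Rightarrow> ('x \<Rightarrow> real) stl \<Rightarrow> bool" where
  "sat x t Tt \<longleftrightarrow> True"
| "sat x t (Pred \<mu>) \<longleftrightarrow> \<mu> (x t) \<ge> 0"
| "sat x t (Conj \<phi> \<psi>) \<longleftrightarrow> sat x t \<phi> \<and> sat x t \<psi>"
| "sat x t (Disj \<phi> \<psi>) \<longleftrightarrow> sat x t \<phi> \<or> sat x t \<psi>"
| "sat x t (Until a b \<phi> \<psi>) \<longleftrightarrow> (\<exists>\<tau>\<in>{t+a..t+b}. sat x \<tau> \<psi> \<and> (\<forall>\<tau>'\<in>{t..\<tau>}. sat x \<tau>' \<phi>))"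
| "sat x t (Eventually a b \<phi>) \<longleftrightarrow> (\<exists>\<tau>\<in>{t+a..t+b}. sat x \<tau> \<phi>)"
| "sat x t (Always a b \<phi>) \<longleftrightarrow> (\<forall>\<tau>\<in>{t+a..t+b}. sat x \<tau> \<phi>)"

lemma sat_Eventually_iff_Until: "sat x t (Eventually a b \<phi>) \<longleftrightarrow> sat x t (Until a b Tt \<phi>)"
  by simp

primrec horizon :: "'p stl \<Rightarrow> nat" where
  "horizon Tt = 0"
| "horizon (Pred \<mu>) = 0"
| "horizon (Conj \<phi> \<psi>) = max (horizon \<phi>) (horizon \<psi>)"
| "horizon (Disj \<phi> \<psi>) = max (horizon \<phi>) (horizon \<psi>)"
| "horizon (Until a b \<phi> \<psi>) = b + max (horizon \<phi>) (horizon \<psi>)"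
| "horizon (Eventually a b \<phi>) = b + horizon \<phi>"
| "horizon (Always a b \<phi>) = b + horizon \<phi>"

text \<open>Trajectories are infinite sequences, but satisfaction at time \<open>t\<close> depends only on the
  segment from \<open>t\<close> to \<open>t + horizon \<phi>\<close>.\<close>

lemma sat_cong_horizon:
  assumes "\<And>s. t \<le> s \<Longrightarrow> s \<le> t + horizon \<phi> \<Longrightarrow> x s = y s"
  shows "sat x t \<phi> \<longleftrightarrow> sat y t \<phi>"
  using assms
proof (induction \<phi> arbitrary: t)
  case (Until a b \<phi> \<psi>)
  have "sat x \<tau> \<psi> = sat y \<tau> \<psi>" if "t \<le> \<tau>" "\<tau> \<le> t + b" for \<tau>
    using that by (intro Until.IH(2) Until.prems) auto
  moreover have "sat x \<tau> \<phi> = sat y \<tau> \<phi>" if "t \<le> \<tau>" "\<tau> \<le> t + b" for \<tau>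
    using that by (intro Until.IH(1) Until.prems) auto
  ultimately show ?case by simp
next
  case (Eventually a b \<phi>)
  have "sat x \<tau> \<phi> = sat y \<tau> \<phi>" if "t \<le> \<tau>" "\<tau> \<le> t + b" for \<tau>
    using that by (intro Eventually.IH Eventually.prems) auto
  then show ?case by auto
next
  case (Always a b \<phi>)
  have "sat x \<tau> \<phi> = sat y \<tau> \<phi>" if "t \<le> \<tau>" "\<tau> \<le> t + b" for \<tau>
    using that by (intro Always.IH Always.prems) auto
  then show ?case by auto
next
  case (Conj \<phi> \<psi>)
  have "sat x t \<phi> = sat y t \<phi>" by (intro Conj.IH(1) Conj.prems) auto
  moreover have "sat x t \<psi> = sat y t \<psi>" by (intro Conj.IH(2) Conj.prems) auto
  ultimately show ?case by simp
next
  case (Disj \<phi> \<psi>)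
  have "sat x t \<phi> = sat y t \<phi>" by (intro Disj.IH(1) Disj.prems) auto
  moreover have "sat x t \<psi> = sat y t \<psi>" by (intro Disj.IH(2) Disj.prems) auto
  ultimately show ?case by simp
qed auto

end

theory Submission
  imports Defs
begin

text \<open>
  If every \<open>e\<^sub>t\<close> with \<open>t \<le> T\<close> lies in \<open>E\<^sub>t\<close>, then \<open>X\<^sub>t = x\<^sub>t + e\<^sub>t\<close> satisfies each predicate whose
  tightened version holds at \<open>x\<^sub>t\<close>, and satisfaction passes to the whole formula because there are no
  negations.  The failure probability is at most the sum over \<open>t\<close> of \<open>P (e\<^sub>t \<notin> E\<^sub>t) \<le> \<theta>\<close>.  The sum has
  only \<open>T\<close> terms: \<open>e\<^sub>0 = 0\<close> is deterministic, so \<open>\<theta> < 1\<close> forces \<open>0 \<in> E\<^sub>0\<close>.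
\<close>

lemma horizon_map_stl [simp]: "horizon (map_stl g \<Phi>) = horizon \<Phi>"
  by (induction \<Phi>) auto

text \<open>Without negation every operator is monotone in its operands, so an implication between
  atoms lifts to the formulas. Both formulas come from one skeleton \<open>\<Phi>\<close>, which
  lets the induction treat them in parallel while the trajectories differ. The implication is
  requested only inside the horizon window, since fluctuation bounds exist only up to
  \<open>T\<close>.\<close>

lemma sat_map_stl_mono:
  assumes "sat x t (map_stl g \<Phi>)"
    and "\<And>i s. i \<in> preds \<Phi> \<Longrightarrow> t \<le> s \<Longrightarrow> s \<le> t + horizon \<Phi> \<Longrightarrow> g i (x s) \<ge> 0 \<Longrightarrow> h i (y s) \<ge> 0"
  shows "sat y t (map_stl h \<Phi>)"
  using assms
proof (induction \<Phi> arbitrary: t)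
  case (Conj \<Phi>1 \<Phi>2)
  have "sat y t (map_stl h \<Phi>1)"
    using Conj.prems(1) by (intro Conj.IH(1) Conj.prems(2)) auto
  moreover have "sat y t (map_stl h \<Phi>2)"
    using Conj.prems(1) by (intro Conj.IH(2) Conj.prems(2)) auto
  ultimately show ?case by simp
next
  case (Disj \<Phi>1 \<Phi>2)
  have "sat y t (map_stl h \<Phi>1)" if "sat x t (map_stl g \<Phi>1)"
    using that by (intro Disj.IH(1) Disj.prems(2)) auto
  moreover have "sat y t (map_stl h \<Phi>2)" if "sat x t (map_stl g \<Phi>2)"
    using that by (intro Disj.IH(2) Disj.prems(2)) auto
  ultimately show ?case using Disj.prems(1) by auto
next
  case (Until a b \<Phi>1 \<Phi>2)
  \<comment> \<open>Both operands are evaluated only at times in \<open>{t..t + b}\<close>. Their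
    own windows then end by \<open>t + b + max (horizon \<Phi>1) (horizon \<Phi>2)\<close>, the end
    of the window of the whole formula.\<close>
  have "sat y \<tau> (map_stl h \<Phi>1)" if "t \<le> \<tau>" "\<tau> \<le> t + b" "sat x \<tau> (map_stl g \<Phi>1)" for \<tau>
    using that by (intro Until.IH(1) Until.prems(2)) auto
  moreover have "sat y \<tau> (map_stl h \<Phi>2)" if "t \<le> \<tau>" "\<tau> \<le> t + b" "sat x \<tau> (map_stl g \<Phi>2)" for \<tau>
    using that by (intro Until.IH(2) Until.prems(2)) auto
  moreover obtain \<tau> where "\<tau> \<in> {t + a..t + b}" "sat x \<tau> (map_stl g \<Phi>2)"
    "\<forall>\<tau>'\<in>{t..\<tau>}. sat x \<tau>' (map_stl g \<Phi>1)"
    using Until.prems(1) by auto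
  ultimately have "sat y \<tau> (map_stl h \<Phi>2)" "\<forall>\<tau>'\<in>{t..\<tau>}. sat y \<tau>' (map_stl h \<Phi>1)"
    by auto
  with \<open>\<tau> \<in> {t + a..t + b}\<close> show ?case by auto
next
  case (Eventually a b \<Phi>)
  have "sat y \<tau> (map_stl h \<Phi>)" if "t \<le> \<tau>" "\<tau> \<le> t + b" "sat x \<tau> (map_stl g \<Phi>)" for \<tau>
    using that by (intro Eventually.IH Eventually.prems(2)) auto
  moreover obtain \<tau> where "\<tau> \<in> {t + a..t + b}" "sat x \<tau> (map_stl g \<Phi>)"
    using Eventually.prems(1) by auto
  ultimately show ?case by (auto intro!: bexI[of _ \<tau>])
next
  case (Always a b \<Phi>)
  have "sat y \<tau> (map_stl h \<Phi>)" if "t \<le> \<tau>" "\<tau> \<le> t + b" "sat x \<tau> (map_stl g \<Phi>)" for \<tau>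
    using that by (intro Always.IH Always.prems(2)) auto
  then show ?case using Always.prems(1) by auto
qed auto

text \<open>Each temporal operator quantifies over a finite set of times, so the satisfaction event
  is a finite Boolean combination of events about single states.\<close>

lemma measurable_sat:
  assumes "\<And>s. t \<le> s \<Longrightarrow> s \<le> t + horizon \<phi> \<Longrightarrow> X s \<in> M \<rightarrow>\<^sub>M N"
    and "\<And>\<mu>. \<mu> \<in> preds \<phi> \<Longrightarrow> \<mu> \<in> borel_measurable N"
  shows "Measurable.pred M (\<lambda>\<omega>. sat (\<lambda>s. X s \<omega>) t \<phi>)"
  using assms
proof (induction \<phi> arbitrary: t)
  case (Pred \<mu>)
  have [measurable]: "X t \<in> M \<rightarrow>\<^sub>M N" "\<mu> \<in> borel_measurable N"
    by (auto intro!: Pred.prems)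
  show ?case by simp
next
  case (Conj \<phi> \<psi>)
  have [measurable]: "Measurable.pred M (\<lambda>\<omega>. sat (\<lambda>s. X s \<omega>) t \<phi>)"
    by (intro Conj.IH(1) Conj.prems) auto
  have [measurable]: "Measurable.pred M (\<lambda>\<omega>. sat (\<lambda>s. X s \<omega>) t \<psi>)"
    by (intro Conj.IH(2) Conj.prems) auto
  show ?case by simp
next
  case (Disj \<phi> \<psi>)
  have [measurable]: "Measurable.pred M (\<lambda>\<omega>. sat (\<lambda>s. X s \<omega>) t \<phi>)"
    by (intro Disj.IH(1) Disj.prems) auto
  have [measurable]: "Measurable.pred M (\<lambda>\<omega>. sat (\<lambda>s. X s \<omega>) t \<psi>)"
    by (intro Disj.IH(2) Disj.prems) auto
  show ?case by simp
next
  case (Until a b \<phi> \<psi>)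
  have "Measurable.pred M (\<lambda>\<omega>. sat (\<lambda>s. X s \<omega>) \<tau> \<phi>)" if "t \<le> \<tau>" "\<tau> \<le> t + b" for \<tau>
    using that by (intro Until.IH(1) Until.prems) auto
  moreover have "Measurable.pred M (\<lambda>\<omega>. sat (\<lambda>s. X s \<omega>) \<tau> \<psi>)" if "t \<le> \<tau>" "\<tau> \<le> t + b" for \<tau>
    using that by (intro Until.IH(2) Until.prems) auto
  ultimately show ?case
    unfolding sat.simps by (intro pred_intros_finite pred_intros_logic) auto
next
  case (Eventually a b \<phi>)
  have "Measurable.pred M (\<lambda>\<omega>. sat (\<lambda>s. X s \<omega>) \<tau> \<phi>)" if "t \<le> \<tau>" "\<tau> \<le> t + b" for \<tau>
    using that by (intro Eventually.IH Eventually.prems) auto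
  then show ?case by (auto intro!: pred_intros_finite)
next
  case (Always a b \<phi>)
  have "Measurable.pred M (\<lambda>\<omega>. sat (\<lambda>s. X s \<omega>) \<tau> \<phi>)" if "t \<le> \<tau>" "\<tau> \<le> t + b" for \<tau>
    using that by (intro Always.IH Always.prems) auto
  then show ?case by (auto intro!: pred_intros_finite)
qed auto

text \<open>The disturbance sequence is fixed, so each step composes a Borel section of
  \<open>f\<close> with the previous state and adds the noise. Asking only for \<open>s < t\<close>
  matches that \<open>d s\<close> is known to lie in \<open>D\<close> only up to
  \<open>T\<close>.\<close>

lemma measurable_stoch_traj:
  assumes "\<And>s. s < t \<Longrightarrow> w s \<in> borel_measurable M"
    and "\<And>s. s < t \<Longrightarrow> (\<lambda>x. f x (d s) s) \<in> borel_measurable borel"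
  shows "stoch_traj f w x0 d t \<in> borel_measurable M"
  using assms
proof (induction t)
  case 0
  have "stoch_traj f w x0 d 0 = (\<lambda>\<omega>. x0)" by (simp add: fun_eq_iff)
  then show ?case by simp
next
  case (Suc t)
  have [measurable]: "stoch_traj f w x0 d t \<in> borel_measurable M" "w t \<in> borel_measurable M"
    "(\<lambda>x. f x (d t) t) \<in> borel_measurable borel"
    using Suc by auto
  have "stoch_traj f w x0 d (Suc t) = (\<lambda>\<omega>. f (stoch_traj f w x0 d t \<omega>) (d t) t + w t \<omega>)"
    by (simp add: fun_eq_iff)
  then show ?case by simp
qed

text \<open>Union bound on the complements, each of probability at most
  \<open>\<theta>\<close>.\<close>

lemma (in prob_space) prob_INT_ge:
  assumes "finite I" and "\<And>i. i \<in> I \<Longrightarrow> A i \<in> events" and "\<And>i. i \<in> I \<Longrightarrow> prob (A i) \<ge> 1 - \<theta>"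
  shows "prob {\<omega> \<in> space M. \<forall>i\<in>I. \<omega> \<in> A i} \<ge> 1 - real (card I) * \<theta>"
proof -
  let ?B = "\<Union>i\<in>I. space M - A i"
  have ev: "?B \<in> events" using assms(1,2) by (intro sets.finite_UN) auto
  have "prob ?B \<le> (\<Sum>i\<in>I. prob (space M - A i))"
    using assms by (intro finite_measure_subadditive_finite) auto
  also have "\<dots> \<le> (\<Sum>i\<in>I. \<theta>)"
    using assms by (intro sum_mono) (force simp: prob_compl)
  finally have "prob ?B \<le> real (card I) * \<theta>" by simp
  moreover have "{\<omega> \<in> space M. \<forall>i\<in>I. \<omega> \<in> A i} = space M - ?B" by auto
  ultimately show ?thesis using prob_compl[OF ev] by simp
qed

theorem theorem1:
  fixes M :: "'w measure"
    and f :: "real^'n \<Rightarrow> 'd::metric_space \<Rightarrow> nat \<Rightarrow> real^'n"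
    and w :: "nat \<Rightarrow> 'w \<Rightarrow> real^'n"
    and X0 :: "(real^'n) set" and D :: "'d set"
    and T :: nat and \<theta> :: real
    and E :: "nat \<Rightarrow> (real^'n) set"
    and x0 :: "real^'n" and d :: "nat \<Rightarrow> 'd"
    and m :: nat and \<pi> \<pi>t :: "nat \<Rightarrow> real^'n \<Rightarrow> real"
    and \<Phi> :: "nat stl" and \<phi> \<phi>t :: "(real^'n \<Rightarrow> real) stl"
  assumes "prob_space M"
    and "bounded D"
    and "\<And>t. w t \<in> borel_measurable M"
    and "\<And>t v. v \<in> D \<Longrightarrow> (\<lambda>x. f x v t) \<in> borel_measurable borel"
    and "T \<ge> 1" and "0 < \<theta>" and "\<theta> < 1"
    and "\<And>t. t \<le> T \<Longrightarrow> is_PRS M f w X0 D \<theta> t (E t)"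
    and "x0 \<in> X0" and "\<And>t. t \<le> T \<Longrightarrow> d t \<in> D"
    and "\<And>i. i \<in> {1..m} \<Longrightarrow> \<pi> i \<in> borel_measurable borel"
    and "preds \<Phi> \<subseteq> {1..m}"
    and "\<phi> = map_stl \<pi> \<Phi>" and "\<phi>t = map_stl \<pi>t \<Phi>"
    and "horizon \<phi> = T"
    and "\<And>i. i \<in> {1..m} \<Longrightarrow> superlevel (\<pi>t i) = superlevel (\<pi> i) \<ominus>\<^sub>P (\<Union>t\<in>{0..T}. E t)"
    and "sat (det_traj f x0 d) 0 \<phi>t"
  shows "measure M {\<omega> \<in> space M. sat (\<lambda>t. stoch_traj f w x0 d t \<omega>) 0 \<phi>} \<ge> 1 - real T * \<theta>"
proof -
  interpret prob_space M by fact
  let ?X = "stoch_traj f w x0 d" and ?x = "det_traj f x0 d" and ?e = "fluctuation f w x0 d"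
  define A where "A t = {\<omega> \<in> space M. ?e t \<omega> \<in> E t}" for t
  have PA: "prob (A t) \<ge> 1 - \<theta>" if "t \<le> T" for t
    using assms(8)[OF that] assms(9,10) that by (auto simp: is_PRS_def A_def)
  \<comment> \<open>A non-measurable set would have \<open>measure\<close> 0, contradicting the
    lower bound \<open>1 - \<theta> > 0\<close>.\<close>
  have evA: "A t \<in> events" if "t \<le> T" for t
    using PA[OF that] \<open>\<theta> < 1\<close> measure_notin_sets[of "A t" M] by fastforce
  have zero: "0 \<in> E 0"
  proof (rule ccontr)
    assume "0 \<notin> E 0"
    then have "A 0 = {}" by (auto simp: A_def fluctuation_def)
    then show False using PA[of 0] \<open>\<theta> < 1\<close> by simp
  qed
  have hor: "horizon \<Phi> = T" using assms(13,15) by simp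
  have sub: "sat (\<lambda>t. ?X t \<omega>) 0 \<phi>" if \<omega>: "\<omega> \<in> space M" "\<forall>t\<in>{1..T}. \<omega> \<in> A t" for \<omega>
    unfolding \<open>\<phi> = map_stl \<pi> \<Phi>\<close>
  proof (rule sat_map_stl_mono)
    show "sat ?x 0 (map_stl \<pi>t \<Phi>)" using assms(14,17) by simp
  next
    fix i s assume i: "i \<in> preds \<Phi>" and s: "s \<le> 0 + horizon \<Phi>" and pos: "\<pi>t i (?x s) \<ge> 0"
    \<comment> \<open>Time 0 is covered by \<open>zero\<close>; the events \<open>A s\<close> serve
      only for \<open>s \<ge> 1\<close>.\<close>
    have "?e s \<omega> \<in> E s"
      using \<omega> s hor zero by (cases "s = 0") (auto simp: A_def fluctuation_def)
    moreover have "?x s \<in> superlevel (\<pi> i) \<ominus>\<^sub>P (\<Union>t\<in>{0..T}. E t)"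
    proof -
      have "i \<in> {1..m}" using assms(12) i by blast
      \<comment> \<open>\<open>\<pi>t i\<close> is specified only through its superlevel set, so its
        sign is first turned into membership.\<close>
      from pos have "?x s \<in> superlevel (\<pi>t i)" by (simp add: superlevel_def)
      then show ?thesis unfolding assms(16)[OF \<open>i \<in> {1..m}\<close>] .
    qed
    ultimately have "?x s + ?e s \<omega> \<in> superlevel (\<pi> i)"
      using s hor by (auto simp: pontryagin_diff_def)
    then show "\<pi> i (?X s \<omega>) \<ge> 0" by (simp add: superlevel_def fluctuation_def)
  qed
  \<comment> \<open>Monotonicity of the measure requires the larger event, satisfaction of
    \<open>\<phi>\<close>, to be measurable.\<close>
  have "?X s \<in> borel_measurable M" if "s \<le> T" for s
    using that by (intro measurable_stoch_traj assms(3,4,10)) auto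
  then have "Measurable.pred M (\<lambda>\<omega>. sat (\<lambda>s. ?X s \<omega>) 0 \<phi>)"
    using assms(11-13) hor by (intro measurable_sat[where N = borel]) (auto simp: stl.set_map)
  then have ev: "{\<omega> \<in> space M. sat (\<lambda>t. ?X t \<omega>) 0 \<phi>} \<in> events" by simp
  have "1 - real T * \<theta> \<le> prob {\<omega> \<in> space M. \<forall>t\<in>{1..T}. \<omega> \<in> A t}"
    using prob_INT_ge[of "{1..T}" A \<theta>] PA evA by simp
  also have "\<dots> \<le> prob {\<omega> \<in> space M. sat (\<lambda>t. ?X t \<omega>) 0 \<phi>}"
    using sub ev by (intro finite_measure_mono) auto
  finally show ?thesis .
qed

end
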